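(* Let a group $G$ be equipped with a bi-invariant word metric $d$, associated with a symmetric generating set $S\subseteq G$, and let $\|g\|=d(g,1)$ be the corresponding norm. (i) A function $f\colon G\to\mathbb{R}$ is Lipschitz with respect to $d$ if and only if it is a partial quasimorphism relative to $\|\cdot\|$ and it is bounded on the generating set $S$. (ii) Moreover, an element $g\in G$ is undistorted with respect to $\|\cdot\|$ if and only if there exists an antisymmetric homogeneous partial quasimorphism $f\colon G\to\mathbb{R}$ relative to $\|\cdot\|$ such that $f(g)>0$ and $f$ is bounded on the generating set $S$.
   Context: For a symmetric generating set $S=S^{-1}$ of $G$, the word norm is $\|g\|=\min\{n\in\mathbb{N} : g=s_1\cdots s_n,\ s_i\in S\}$ (with $\|1\|=0$), and the word metric is $d(g,h)=\|gh^{-1}\|$. The metric is bi-invariant (both left- and right-invariant) if and only if $S$ is normal, i.e. $g^{-1}Sg=S$ for all $g\in G$. A function $f\colon G\to\mathbb{R}$ is: - Lipschitz if there is $C>0$ with $|f(g)-f(h)|\le C\,d(g,h)$ for all $g,h\in G$; - a partial quasimorphism relative to $\|\cdot\|$ if there is $D\ge 0$ with $|f(g)-f(gh)+f(h)|\le D\min\{\|g\|,\|h\|\}$ for all $g,h\in G$; - homogeneous if $f(g^n)=nf(g)$ for all $g\in G$, $n\in\mathbb{N}$; - antisymmetric if $f(g^{-1})=-f(g)$ for all $g\in G$; - bounded on $S$ if $\sup_{s\in S}|f(s)|<\infty$. An element $g\in G$ is undistorted with respect to $\|\cdot\|$ if there is $C>0$ with $\|g^n\|\ge Cn$ for all $n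\in\mathbb{N}$.
   Formalization: In (i) the condition f(1)=0 is added to "f is Lipschitz": nonzero constant functions are Lipschitz, but the partial quasimorphism inequality with h=1 forces f(1)=0, so (i) is false as printed. *)

theory Defs
  imports Complex_Main "HOL-Algebra.Generated_Groups"
begin

definition symmetric_generating_set :: "('a, 'b) monoid_scheme \<Rightarrow> 'a set \<Rightarrow> bool" where
  "symmetric_generating_set G S \<longleftrightarrow>
     S \<subseteq> carrier G \<and> (\<lambda>s. inv\<^bsub>G\<^esub> s) ` S = S \<and> generate G S = carrier G"

text \<open>The empty word is allowed, so the identity has norm 0.  The set in the \<open>LEAST\<close> is
  nonempty only if the element is a product of elements of S, which holds for every group
  element when S is a symmetric generating set.\<close>

definition word_norm :: "('a, 'b) monoid_scheme \<Rightarrow> 'a set \<Rightarrow> 'a \<Rightarrow> nat" where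
  "word_norm G S g =
     (LEAST n. \<exists>w. length w = n \<and> set w \<subseteq> S \<and> foldr (\<otimes>\<^bsub>G\<^esub>) w \<one>\<^bsub>G\<^esub> = g)"

definition word_dist :: "('a, 'b) monoid_scheme \<Rightarrow> 'a set \<Rightarrow> 'a \<Rightarrow> 'a \<Rightarrow> nat" where
  "word_dist G S g h = word_norm G S (g \<otimes>\<^bsub>G\<^esub> inv\<^bsub>G\<^esub> h)"

definition bi_invariant :: "('a, 'b) monoid_scheme \<Rightarrow> ('a \<Rightarrow> 'a \<Rightarrow> nat) \<Rightarrow> bool" where
  "bi_invariant G d \<longleftrightarrow>
     (\<forall>g\<in>carrier G. \<forall>h\<in>carrier G. \<forall>k\<in>carrier G.
        d (k \<otimes>\<^bsub>G\<^esub> g) (k \<otimes>\<^bsub>G\<^esub> h) = d g h \<and> d (g \<otimes>\<^bsub>G\<^esub> k) (h \<otimes>\<^bsub>G\<^esub> k) = d g h)"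

definition lipschitz_wrt ::
    "('a, 'b) monoid_scheme \<Rightarrow> ('a \<Rightarrow> 'a \<Rightarrow> nat) \<Rightarrow> ('a \<Rightarrow> real) \<Rightarrow> bool" where
  "lipschitz_wrt G d f \<longleftrightarrow>
     (\<exists>C>0. \<forall>g\<in>carrier G. \<forall>h\<in>carrier G. \<bar>f g - f h\<bar> \<le> C * real (d g h))"

text \<open>Taking h to be the identity in the following definition forces f to vanish at the
  identity.\<close>

definition partial_quasimorphism ::
    "('a, 'b) monoid_scheme \<Rightarrow> ('a \<Rightarrow> nat) \<Rightarrow> ('a \<Rightarrow> real) \<Rightarrow> bool" where
  "partial_quasimorphism G N f \<longleftrightarrow>
     (\<exists>D\<ge>0. \<forall>g\<in>carrier G. \<forall>h\<in>carrier G.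
        \<bar>f g - f (g \<otimes>\<^bsub>G\<^esub> h) + f h\<bar> \<le> D * real (min (N g) (N h)))"

definition homogeneous :: "('a, 'b) monoid_scheme \<Rightarrow> ('a \<Rightarrow> real) \<Rightarrow> bool" where
  "homogeneous G f \<longleftrightarrow> (\<forall>g\<in>carrier G. \<forall>n::nat. f (g [^]\<^bsub>G\<^esub> n) = real n * f g)"

definition antisymmetric :: "('a, 'b) monoid_scheme \<Rightarrow> ('a \<Rightarrow> real) \<Rightarrow> bool" where
  "antisymmetric G f \<longleftrightarrow> (\<forall>g\<in>carrier G. f (inv\<^bsub>G\<^esub> g) = - f g)"

definition bounded_on_set :: "'a set \<Rightarrow> ('a \<Rightarrow> real) \<Rightarrow> bool" where
  "bounded_on_set S f \<longleftrightarrow> bdd_above ((\<lambda>s. \<bar>f s\<bar>) ` S)"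

definition undistorted :: "('a, 'b) monoid_scheme \<Rightarrow> ('a \<Rightarrow> nat) \<Rightarrow> 'a \<Rightarrow> bool" where
  "undistorted G N g \<longleftrightarrow> (\<exists>C::real. C > 0 \<and> (\<forall>n::nat. real (N (g [^]\<^bsub>G\<^esub> n)) \<ge> C * real n))"

end

theory Submission
  imports Defs
begin

text \<open>
  For the first equivalence, bi-invariance gives \<open>d (g h) g = \<parallel>h\<parallel>\<close> and \<open>d (g h) h = \<parallel>g\<parallel>\<close>, so a
  \<open>C\<close>-Lipschitz function vanishing at the identity satisfies the partial quasimorphism inequality
  with \<open>D = 2 C\<close>. Conversely, multiplying by one generator on the left changes a partial
  quasimorphism that is bounded by \<open>B\<close> on \<open>S\<close> by at most \<open>D + B\<close>; adding up along a shortest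
  word for \<open>g h\<^sup>-\<^sup>1\<close> gives the Lipschitz bound (\<open>partial_quasimorphism_word_bound\<close>).

  In the second equivalence, a homogeneous Lipschitz function satisfies
  \<open>n f(g) = f(g\<^sup>n) \<le> C \<parallel>g\<^sup>n\<parallel>\<close>, so \<open>f(g) > 0\<close> forces \<open>g\<close> to be undistorted. For the other
  direction a homogeneous function must be produced. Bi-invariance makes \<open>n \<mapsto> d(x\<^sup>n, y\<^sup>n)\<close>
  subadditive, and the asymptotic distance \<open>\<rho>(x, y) = inf d(x\<^sup>n, y\<^sup>n) / n\<close> is a pseudometric
  below \<open>d\<close> that scales exactly: \<open>\<rho>(x\<^sup>k, y\<^sup>k) = k \<rho>(x, y)\<close> (\<open>asym_dist_pow\<close>). The element \<open>g\<close>
  is undistorted iff \<open>\<tau> = \<rho>(1, g)\<close> is positive, and then \<open>m \<mapsto> g\<^sup>m\<close> is a geodesic ray for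
  \<open>\<rho>\<close> of speed \<open>\<tau>\<close>. Its Busemann function \<open>b(x) = lim (\<rho>(x, g\<^sup>m) - m \<tau>)\<close> is Lipschitz, as every
  Busemann function is, and it is homogeneous because replacing \<open>x\<close> by \<open>x\<^sup>k\<close> and passing to the
  subsequence \<open>g\<^sup>k\<^sup>m\<close> multiplies everything by \<open>k\<close> (\<open>busemann_pow\<close>). Antisymmetrizing, the function
  \<open>f(x) = (b(x\<^sup>-\<^sup>1) - b(x)) / 2\<close> keeps these properties and has \<open>f(g) > 0\<close>, since \<open>b\<close> decreases
  along the ray and increases against it.
\<close>

section \<open>Asymptotic distance of a bi-invariant pseudometric\<close>

locale bi_invariant_pseudometric = group G for G :: "('a, 'b) monoid_scheme" (structure) +
  fixes d :: "'a \<Rightarrow> 'a \<Rightarrow> real"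
  assumes dist_nonneg: "\<lbrakk>x \<in> carrier G; y \<in> carrier G\<rbrakk> \<Longrightarrow> 0 \<le> d x y"
    and dist_refl: "x \<in> carrier G \<Longrightarrow> d x x = 0"
    and dist_sym: "\<lbrakk>x \<in> carrier G; y \<in> carrier G\<rbrakk> \<Longrightarrow> d x y = d y x"
    and dist_triangle:
      "\<lbrakk>x \<in> carrier G; y \<in> carrier G; z \<in> carrier G\<rbrakk> \<Longrightarrow> d x z \<le> d x y + d y z"
    and dist_left: "\<lbrakk>x \<in> carrier G; y \<in> carrier G; z \<in> carrier G\<rbrakk> \<Longrightarrow> d (z \<otimes> x) (z \<otimes> y) = d x y"
    and dist_right: "\<lbrakk>x \<in> carrier G; y \<in> carrier G; z \<in> carrier G\<rbrakk> \<Longrightarrow> d (x \<otimes> z) (y \<otimes> z) = d x y"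
begin

lemma dist_mult_le:
  assumes "x \<in> carrier G" "y \<in> carrier G" "x' \<in> carrier G" "y' \<in> carrier G"
  shows "d (x \<otimes> y) (x' \<otimes> y') \<le> d x x' + d y y'"
  using dist_triangle[of "x \<otimes> y" "x' \<otimes> y" "x' \<otimes> y'"] dist_right[of x x' y] dist_left[of y y' x']
    assms by simp

lemma dist_pow_le:
  assumes "x \<in> carrier G" "y \<in> carrier G"
  shows "d (x [^] (n::nat)) (y [^] n) \<le> real n * d x y"
proof (induction n)
  case 0
  then show ?case by (simp add: dist_refl)
next
  case (Suc n)
  then show ?case
    using dist_mult_le[of "x [^] n" x "y [^] n" y] assms by (simp add: algebra_simps)
qed

lemma dist_inv:
  assumes x: "x \<in> carrier G" and y: "y \<in> carrier G"
  shows "d (inv x) (inv y) = d x y"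
proof -
  have "d (inv x) (inv y) = d (x \<otimes> inv x \<otimes> y) (x \<otimes> inv y \<otimes> y)"
    using x y dist_left[of "inv x" "inv y" x] dist_right[of "x \<otimes> inv x" "x \<otimes> inv y" y] by simp
  also have "\<dots> = d y x"
    using x y by (simp add: m_assoc)
  finally show ?thesis
    using dist_sym x y by simp
qed

definition asym_dist :: "'a \<Rightarrow> 'a \<Rightarrow> real" where
  "asym_dist x y = (INF n\<in>{0<..}. d (x [^] n) (y [^] n) / real (n::nat))"

lemma asym_dist_le:
  assumes "x \<in> carrier G" "y \<in> carrier G" "n > 0"
  shows "asym_dist x y \<le> d (x [^] n) (y [^] n) / real n"
  unfolding asym_dist_def
proof (rule cINF_lower)
  show "bdd_below ((\<lambda>n::nat. d (x [^] n) (y [^] n) / real n) ` {0<..})"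
    using assms by (intro bdd_belowI[of _ 0]) (auto intro!: divide_nonneg_nonneg dist_nonneg)
qed (use assms in simp)

lemma asym_dist_greatest:
  assumes "\<And>n::nat. n > 0 \<Longrightarrow> c \<le> d (x [^] n) (y [^] n) / real n"
  shows "c \<le> asym_dist x y"
  unfolding asym_dist_def using assms by (intro cINF_greatest) auto

lemma asym_dist_nonneg:
  assumes "x \<in> carrier G" "y \<in> carrier G"
  shows "0 \<le> asym_dist x y"
  using assms by (intro asym_dist_greatest divide_nonneg_nonneg dist_nonneg) auto

lemma asym_dist_le_dist:
  assumes "x \<in> carrier G" "y \<in> carrier G"
  shows "asym_dist x y \<le> d x y"
  using asym_dist_le[of x y 1] assms by simp

lemma asym_dist_refl: "x \<in> carrier G \<Longrightarrow> asym_dist x x = 0"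
  using asym_dist_le_dist[of x x] asym_dist_nonneg[of x x] dist_refl[of x] by simp

text \<open>A quotient for \<open>(x, y)\<close> at exponent \<open>n\<close> and one for \<open>(y, z)\<close> at exponent \<open>m\<close> are
  compared at the common exponent \<open>n m\<close>: by \<open>dist_pow_le\<close> a quotient does not increase when its
  exponent is replaced by a multiple.\<close>

lemma asym_dist_triangle:
  assumes x: "x \<in> carrier G" and y: "y \<in> carrier G" and z: "z \<in> carrier G"
  shows "asym_dist x z \<le> asym_dist x y + asym_dist y z"
proof -
  have step: "asym_dist x z \<le> d (x [^] n) (y [^] n) / real n + d (y [^] m) (z [^] m) / real m"
    if n: "n > 0" and m: "m > 0" for n m :: nat
  proof -
    have "d (x [^] (n * m)) (z [^] (n * m))
        \<le> d (x [^] (n * m)) (y [^] (n * m)) + d (y [^] (n * m)) (z [^] (n * m))"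
      using x y z by (intro dist_triangle) auto
    also have "d (x [^] (n * m)) (y [^] (n * m)) \<le> real m * d (x [^] n) (y [^] n)"
      using dist_pow_le[of "x [^] n" "y [^] n" m] x y by (simp add: nat_pow_pow)
    also have "d (y [^] (n * m)) (z [^] (n * m)) \<le> real n * d (y [^] m) (z [^] m)"
      using dist_pow_le[of "y [^] m" "z [^] m" n] y z by (simp add: nat_pow_pow mult.commute)
    finally have "d (x [^] (n * m)) (z [^] (n * m)) / real (n * m)
        \<le> (real m * d (x [^] n) (y [^] n) + real n * d (y [^] m) (z [^] m)) / real (n * m)"
      by (intro divide_right_mono) auto
    also have "\<dots> = d (x [^] n) (y [^] n) / real n + d (y [^] m) (z [^] m) / real m"
      using n m by (simp add: field_simps)
    finally show ?thesis
      using asym_dist_le[of x z "n * m"] x z n m by simp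
  qed
  have "asym_dist x z - d (x [^] n) (y [^] n) / real n \<le> asym_dist y z" if "n > 0" for n :: nat
    using step[OF that] by (intro asym_dist_greatest) (auto simp: algebra_simps)
  then have "asym_dist x z - asym_dist y z \<le> asym_dist x y"
    by (intro asym_dist_greatest) (auto simp: algebra_simps)
  then show ?thesis by simp
qed

text \<open>The exponents divisible by \<open>k\<close> already realize the infimum, because passing from \<open>n\<close> to \<open>k n\<close>
  does not increase the quotient.\<close>

lemma asym_dist_pow:
  assumes x: "x \<in> carrier G" and y: "y \<in> carrier G"
  shows "asym_dist (x [^] (k::nat)) (y [^] k) = real k * asym_dist x y"
proof (cases "k = 0")
  case True
  then show ?thesis by (simp add: asym_dist_refl)
next
  case False
  then have k: "k > 0" by simp
  have "asym_dist (x [^] k) (y [^] k) / real k \<le> asym_dist x y"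
  proof (rule asym_dist_greatest)
    fix n :: nat assume n: "n > 0"
    have "asym_dist (x [^] k) (y [^] k) \<le> d (x [^] (k * n)) (y [^] (k * n)) / real n"
      using asym_dist_le[of "x [^] k" "y [^] k" n] x y n by (simp add: nat_pow_pow)
    also have "d (x [^] (k * n)) (y [^] (k * n)) \<le> real k * d (x [^] n) (y [^] n)"
      using dist_pow_le[of "x [^] n" "y [^] n" k] x y by (simp add: nat_pow_pow mult.commute)
    finally show "asym_dist (x [^] k) (y [^] k) / real k \<le> d (x [^] n) (y [^] n) / real n"
      using k n by (simp add: field_simps)
  qed
  moreover have "real k * asym_dist x y \<le> asym_dist (x [^] k) (y [^] k)"
  proof (rule asym_dist_greatest)
    fix n :: nat assume n: "n > 0"
    have "asym_dist x y \<le> d (x [^] (k * n)) (y [^] (k * n)) / real (k * n)"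
      using asym_dist_le[of x y "k * n"] x y k n by simp
    then show "real k * asym_dist x y \<le> d ((x [^] k) [^] n) ((y [^] k) [^] n) / real n"
      using x y k n by (simp add: nat_pow_pow field_simps)
  qed
  ultimately show ?thesis
    using k by (simp add: field_simps)
qed

text \<open>Bi-invariance of \<open>d\<close> applies to the powers because \<open>(x z)\<^sup>n = x\<^sup>n z\<^sup>n\<close> when \<open>x\<close> and \<open>z\<close>
  commute. Within the cyclic group generated by \<open>g\<close> this makes all consecutive points of the ray
  \<open>m \<mapsto> g\<^sup>m\<close> equally far apart.\<close>

lemma asym_dist_translate:
  assumes x: "x \<in> carrier G" and y: "y \<in> carrier G" and z: "z \<in> carrier G"
    and xz: "x \<otimes> z = z \<otimes> x" and yz: "y \<otimes> z = z \<otimes> y"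
  shows "asym_dist (x \<otimes> z) (y \<otimes> z) = asym_dist x y"
  unfolding asym_dist_def
  using x y z by (simp add: pow_mult_distrib[OF xz] pow_mult_distrib[OF yz] dist_right)

section \<open>The Busemann function of a cyclic ray\<close>

text \<open>The sequence \<open>\<rho>(x, g\<^sup>m) - m \<rho>(1, g)\<close> is nonincreasing in \<open>m\<close> (\<open>busemann_term_antimono\<close>), so
  its infimum is the limit that defines a Busemann function.\<close>

definition busemann :: "'a \<Rightarrow> 'a \<Rightarrow> real" where
  "busemann g x = (INF m. asym_dist x (g [^] (m::nat)) - real m * asym_dist \<one> g)"

lemma asym_dist_one_pow:
  assumes "g \<in> carrier G"
  shows "asym_dist \<one> (g [^] (m::nat)) = real m * asym_dist \<one> g"
  using asym_dist_pow[of \<one> g m] assms by simp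

lemma busemann_term_antimono:
  assumes g: "g \<in> carrier G" and x: "x \<in> carrier G"
  shows "antimono (\<lambda>m::nat. asym_dist x (g [^] m) - real m * asym_dist \<one> g)"
proof (rule decseq_SucI)
  fix m :: nat
  have "asym_dist (g [^] m) (g [^] Suc m) = asym_dist \<one> g"
    using asym_dist_translate[of \<one> g "g [^] m"] g nat_pow_Suc2[of g m] by simp
  then show "asym_dist x (g [^] Suc m) - real (Suc m) * asym_dist \<one> g
      \<le> asym_dist x (g [^] m) - real m * asym_dist \<one> g"
    using asym_dist_triangle[of x "g [^] m" "g [^] Suc m"] g x by (simp add: algebra_simps)
qed

lemma busemann_le:
  assumes g: "g \<in> carrier G" and x: "x \<in> carrier G"
  shows "busemann g x \<le> asym_dist x (g [^] (m::nat)) - real m * asym_dist \<one> g"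
  unfolding busemann_def
proof (rule cINF_lower)
  have "- asym_dist \<one> x \<le> asym_dist x (g [^] m) - real m * asym_dist \<one> g" for m :: nat
    using asym_dist_triangle[of \<one> x "g [^] m"] asym_dist_one_pow[of g m] g x by simp
  then show "bdd_below (range (\<lambda>m::nat. asym_dist x (g [^] m) - real m * asym_dist \<one> g))"
    by (intro bdd_belowI[of _ "- asym_dist \<one> x"]) auto
qed simp

lemma busemann_greatest:
  assumes "\<And>m::nat. c \<le> asym_dist x (g [^] m) - real m * asym_dist \<one> g"
  shows "c \<le> busemann g x"
  unfolding busemann_def using assms by (intro cINF_greatest) auto

lemma busemann_lipschitz:
  assumes g: "g \<in> carrier G" and x: "x \<in> carrier G" and y: "y \<in> carrier G"
  shows "\<bar>busemann g x - busemann g y\<bar> \<le> d x y"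
proof -
  have one_sided: "busemann g u - d u v \<le> busemann g v"
    if u: "u \<in> carrier G" and v: "v \<in> carrier G" for u v
  proof (rule busemann_greatest)
    fix m :: nat
    have "asym_dist u (g [^] m) \<le> d u v + asym_dist v (g [^] m)"
      using asym_dist_triangle[of u v "g [^] m"] asym_dist_le_dist[of u v] g u v by simp
    then show "busemann g u - d u v \<le> asym_dist v (g [^] m) - real m * asym_dist \<one> g"
      using busemann_le[of g u m] g u by simp
  qed
  show ?thesis
    using one_sided[of x y] one_sided[of y x] dist_sym[of x y] x y by (simp add: abs_le_iff)
qed

lemma busemann_one:
  assumes "g \<in> carrier G"
  shows "busemann g \<one> = 0"
  using assms by (simp add: busemann_def asym_dist_one_pow)

text \<open>By monotonicity the infimum may be taken over the multiples of \<open>k\<close>, and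
  \<open>\<rho>(x\<^sup>k, g\<^sup>k\<^sup>m) - k m \<rho>(1, g)\<close> is \<open>k\<close> times the term for \<open>x\<close> and \<open>m\<close>.\<close>

lemma busemann_pow:
  assumes g: "g \<in> carrier G" and x: "x \<in> carrier G"
  shows "busemann g (x [^] (k::nat)) = real k * busemann g x"
proof (cases "k = 0")
  case True
  then show ?thesis using g by (simp add: busemann_one)
next
  case False
  then have k: "k > 0" by simp
  have scale: "asym_dist (x [^] k) (g [^] (k * m)) - real (k * m) * asym_dist \<one> g
      = real k * (asym_dist x (g [^] m) - real m * asym_dist \<one> g)" for m :: nat
    using asym_dist_pow[of x "g [^] m" k] g x by (simp add: nat_pow_pow mult.commute algebra_simps)
  have "busemann g (x [^] k) / real k \<le> busemann g x"
  proof (rule busemann_greatest)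
    fix m :: nat
    show "busemann g (x [^] k) / real k \<le> asym_dist x (g [^] m) - real m * asym_dist \<one> g"
      using busemann_le[of g "x [^] k" "k * m"] scale[of m] g x k
      by (simp add: divide_le_eq mult.commute)
  qed
  moreover have "real k * busemann g x \<le> busemann g (x [^] k)"
  proof (rule busemann_greatest)
    fix m :: nat
    have "real k * busemann g x \<le> real k * (asym_dist x (g [^] m) - real m * asym_dist \<one> g)"
      using busemann_le[of g x m] g x by (intro mult_left_mono) auto
    also have "\<dots> = asym_dist (x [^] k) (g [^] (k * m)) - real (k * m) * asym_dist \<one> g"
      using scale by simp
    also have "\<dots> \<le> asym_dist (x [^] k) (g [^] m) - real m * asym_dist \<one> g"
      using antimonoD[OF busemann_term_antimono[of g "x [^] k"], of m "k * m"] g x k by simp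
    finally show "real k * busemann g x
        \<le> asym_dist (x [^] k) (g [^] m) - real m * asym_dist \<one> g" .
  qed
  ultimately show ?thesis
    using k by (simp add: field_simps)
qed

lemma busemann_self_le:
  assumes "g \<in> carrier G"
  shows "busemann g g \<le> - asym_dist \<one> g"
  using busemann_le[of g g 1] assms by (simp add: asym_dist_refl)

lemma busemann_inv_self_ge:
  assumes g: "g \<in> carrier G"
  shows "asym_dist \<one> g \<le> busemann g (inv g)"
proof (rule busemann_greatest)
  fix m :: nat
  have "asym_dist (inv g) (g [^] m) = asym_dist (inv g \<otimes> g) (g [^] m \<otimes> g)"
    using g nat_pow_Suc2[of g m] by (intro asym_dist_translate[symmetric]) auto
  also have "\<dots> = real (Suc m) * asym_dist \<one> g"
    using g asym_dist_one_pow[of g "Suc m"] by simp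
  finally show "asym_dist \<one> g \<le> asym_dist (inv g) (g [^] m) - real m * asym_dist \<one> g"
    by (simp add: algebra_simps)
qed

text \<open>The Busemann function itself need not be antisymmetric, since the powers of \<open>x\<^sup>-\<^sup>1\<close> may also
  move away from the ray when those of \<open>x\<close> do; taking the odd part repairs this. The sign is chosen
  so that the result is positive at \<open>g\<close>, where \<open>busemann g\<close> is negative.\<close>

lemma homogeneous_lipschitz_function_exists:
  assumes g: "g \<in> carrier G" and pos: "asym_dist \<one> g > 0"
  obtains f :: "'a \<Rightarrow> real" where "antisymmetric G f" "homogeneous G f" "f g > 0"
    "\<And>x y. \<lbrakk>x \<in> carrier G; y \<in> carrier G\<rbrakk> \<Longrightarrow> \<bar>f x - f y\<bar> \<le> d x y"
proof
  let ?f = "\<lambda>x. (busemann g (inv x) - busemann g x) / 2"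
  show "antisymmetric G ?f"
    by (auto simp: antisymmetric_def field_simps)
  show "homogeneous G ?f"
    using g by (auto simp: homogeneous_def nat_pow_inv[symmetric] busemann_pow field_simps)
  show "?f g > 0"
    using busemann_self_le[OF g] busemann_inv_self_ge[OF g] pos by simp
  show "\<bar>?f x - ?f y\<bar> \<le> d x y" if x: "x \<in> carrier G" and y: "y \<in> carrier G" for x y
    using busemann_lipschitz[OF g x y] busemann_lipschitz[of g "inv x" "inv y"]
      dist_inv[OF x y] g x y by (simp add: abs_le_iff field_simps)
qed

end

section \<open>Word norms\<close>

context group
begin

lemma foldr_mult_closed:
  "set w \<subseteq> carrier G \<Longrightarrow> foldr (\<otimes>) w \<one> \<in> carrier G"
  by (induction w) auto

lemma foldr_mult_append:
  assumes "set u \<subseteq> carrier G" "set v \<subseteq> carrier G"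
  shows "foldr (\<otimes>) (u @ v) \<one> = foldr (\<otimes>) u \<one> \<otimes> foldr (\<otimes>) v \<one>"
  using assms by (induction u) (auto simp: foldr_mult_closed m_assoc simp del: foldr_append)

lemma word_norm_le:
  "set w \<subseteq> S \<Longrightarrow> word_norm G S (foldr (\<otimes>) w \<one>) \<le> length w"
  unfolding word_norm_def by (rule Least_le) auto

lemma word_norm_one: "word_norm G S \<one> = 0"
  using word_norm_le[of "[]" S] by simp

lemma word_norm_generator:
  assumes "S \<subseteq> carrier G" "s \<in> S"
  shows "word_norm G S s \<le> 1"
proof -
  have "s \<in> carrier G" using assms by auto
  then show ?thesis using word_norm_le[of "[s]" S] assms by simp
qed

lemma symmetric_generating_setD:
  assumes "symmetric_generating_set G S"
  shows "S \<subseteq> carrier G" "\<And>s. s \<in> S \<Longrightarrow> inv s \<in> S" "generate G S = carrier G"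
  using assms by (auto simp: symmetric_generating_set_def)

lemma shortest_word_exists:
  assumes S: "symmetric_generating_set G S" and g: "g \<in> carrier G"
  obtains w where "set w \<subseteq> S" "foldr (\<otimes>) w \<one> = g" "length w = word_norm G S g"
proof -
  note S' = symmetric_generating_setD[OF S]
  have "g \<in> generate G S" using g S' by simp
  then have "\<exists>w. set w \<subseteq> S \<and> foldr (\<otimes>) w \<one> = g"
  proof (induction rule: generate.induct)
    case one
    then show ?case by (intro exI[of _ "[]"]) simp
  next
    case (incl s)
    then show ?case using S'(1) by (intro exI[of _ "[s]"]) auto
  next
    case (inv s)
    then show ?case using S'(1,2) by (intro exI[of _ "[inv s]"]) auto
  next
    case (eng h1 h2)
    then obtain u v where "set u \<subseteq> S" "foldr (\<otimes>) u \<one> = h1" "set v \<subseteq> S" "foldr (\<otimes>) v \<one> = h2"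
      by auto
    then show ?case
      using S'(1) foldr_mult_append[of u v] by (intro exI[of _ "u @ v"]) auto
  qed
  then obtain w where "set w \<subseteq> S" "foldr (\<otimes>) w \<one> = g" by blast
  then have "\<exists>w. length w = word_norm G S g \<and> set w \<subseteq> S \<and> foldr (\<otimes>) w \<one> = g"
    unfolding word_norm_def
    by (intro LeastI_ex[of "\<lambda>n. \<exists>w. length w = n \<and> set w \<subseteq> S \<and> foldr (\<otimes>) w \<one> = g"]) blast
  then show thesis using that by blast
qed

lemma word_norm_mult_le:
  assumes S: "symmetric_generating_set G S" and x: "x \<in> carrier G" and y: "y \<in> carrier G"
  shows "word_norm G S (x \<otimes> y) \<le> word_norm G S x + word_norm G S y"
proof -
  obtain u where u: "set u \<subseteq> S" "foldr (\<otimes>) u \<one> = x" "length u = word_norm G S x"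
    using shortest_word_exists[OF S x] .
  obtain v where v: "set v \<subseteq> S" "foldr (\<otimes>) v \<one> = y" "length v = word_norm G S y"
    using shortest_word_exists[OF S y] .
  have "foldr (\<otimes>) (u @ v) \<one> = x \<otimes> y"
    using foldr_mult_append[of u v] u v symmetric_generating_setD(1)[OF S] by auto
  then show ?thesis
    using word_norm_le[of "u @ v" S] u v by simp
qed

lemma word_norm_inv_le:
  assumes S: "symmetric_generating_set G S" and x: "x \<in> carrier G"
  shows "word_norm G S (inv x) \<le> word_norm G S x"
proof -
  note S' = symmetric_generating_setD[OF S]
  have bound: "word_norm G S (inv (foldr (\<otimes>) w \<one>)) \<le> length w" if "set w \<subseteq> S" for w
    using that
  proof (induction w)
    case Nil
    then show ?case by (simp add: word_norm_one)
  next
    case (Cons s w)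
    then have s: "s \<in> S" "s \<in> carrier G" and w: "foldr (\<otimes>) w \<one> \<in> carrier G"
      using S'(1) by (auto intro!: foldr_mult_closed)
    have "word_norm G S (inv (foldr (\<otimes>) w \<one>) \<otimes> inv s)
        \<le> word_norm G S (inv (foldr (\<otimes>) w \<one>)) + word_norm G S (inv s)"
      using s w by (intro word_norm_mult_le[OF S]) auto
    moreover have "word_norm G S (inv s) \<le> 1"
      using s S' by (intro word_norm_generator) auto
    ultimately show ?case
      using Cons s w by (simp add: inv_mult_group)
  qed
  obtain w where "set w \<subseteq> S" "foldr (\<otimes>) w \<one> = x" "length w = word_norm G S x"
    using shortest_word_exists[OF S x] .
  then show ?thesis using bound[of w] by simp
qed

lemma word_norm_inv:
  assumes S: "symmetric_generating_set G S" and x: "x \<in> carrier G"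
  shows "word_norm G S (inv x) = word_norm G S x"
  using word_norm_inv_le[OF S x] word_norm_inv_le[OF S, of "inv x"] x by simp

lemma word_dist_sym:
  assumes S: "symmetric_generating_set G S" and x: "x \<in> carrier G" and y: "y \<in> carrier G"
  shows "word_dist G S x y = word_dist G S y x"
  unfolding word_dist_def
  using word_norm_inv[OF S, of "x \<otimes> inv y"] x y by (simp add: inv_mult_group)

lemma word_dist_triangle:
  assumes S: "symmetric_generating_set G S"
    and x: "x \<in> carrier G" and y: "y \<in> carrier G" and z: "z \<in> carrier G"
  shows "word_dist G S x z \<le> word_dist G S x y + word_dist G S y z"
proof -
  have "x \<otimes> inv z = (x \<otimes> inv y) \<otimes> (y \<otimes> inv z)"
    using x y z by (metis inv_closed l_inv l_one m_assoc m_closed)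
  then show ?thesis
    unfolding word_dist_def using word_norm_mult_le[OF S, of "x \<otimes> inv y" "y \<otimes> inv z"] x y z by simp
qed

lemma word_dist_one:
  "x \<in> carrier G \<Longrightarrow> word_dist G S x \<one> = word_norm G S x"
  by (simp add: word_dist_def)

lemma bi_invariant_pseudometric_word_dist:
  assumes S: "symmetric_generating_set G S" and bi: "bi_invariant G (word_dist G S)"
  shows "bi_invariant_pseudometric G (\<lambda>x y. real (word_dist G S x y))"
proof unfold_locales
  fix x y z assume xyz: "x \<in> carrier G" "y \<in> carrier G" "z \<in> carrier G"
  show "real (word_dist G S x z) \<le> real (word_dist G S x y) + real (word_dist G S y z)"
    using word_dist_triangle[OF S xyz] by linarith
  show "real (word_dist G S (z \<otimes> x) (z \<otimes> y)) = real (word_dist G S x y)"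
    "real (word_dist G S (x \<otimes> z) (y \<otimes> z)) = real (word_dist G S x y)"
    using bi xyz by (simp_all add: bi_invariant_def)
qed (use word_dist_sym[OF S] in \<open>simp_all add: word_dist_def word_norm_one\<close>)

section \<open>Lipschitz functions and partial quasimorphisms\<close>

text \<open>Left invariance gives \<open>d (g h) g = \<parallel>h\<parallel>\<close>, so \<open>f g - f (g h)\<close> and \<open>f h\<close> are both at most
  \<open>C \<parallel>h\<parallel>\<close> in absolute value; right invariance, with the terms paired the other way, bounds the
  same defect by \<open>2 C \<parallel>g\<parallel>\<close>. Both invariances together give the minimum of the two norms.\<close>

lemma lipschitz_imp_partial_quasimorphism:
  assumes S: "symmetric_generating_set G S" and bi: "bi_invariant G (word_dist G S)"
    and lip: "lipschitz_wrt G (word_dist G S) f" and f1: "f \<one> = 0"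
  shows "partial_quasimorphism G (word_norm G S) f"
proof -
  obtain C where C: "C > 0"
    and lip: "\<And>g h. \<lbrakk>g \<in> carrier G; h \<in> carrier G\<rbrakk> \<Longrightarrow> \<bar>f g - f h\<bar> \<le> C * real (word_dist G S g h)"
    using lip by (auto simp: lipschitz_wrt_def)
  have norm: "\<bar>f g\<bar> \<le> C * real (word_norm G S g)" if "g \<in> carrier G" for g
    using lip[of g \<one>] that by (simp add: f1 word_dist_one)
  have "\<bar>f g - f (g \<otimes> h) + f h\<bar> \<le> 2 * C * real (min (word_norm G S g) (word_norm G S h))"
    if g: "g \<in> carrier G" and h: "h \<in> carrier G" for g h
  proof -
    have "word_dist G S (g \<otimes> h) (g \<otimes> \<one>) = word_dist G S h \<one>"
      "word_dist G S (g \<otimes> h) (\<one> \<otimes> h) = word_dist G S g \<one>"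
      using bi g h unfolding bi_invariant_def by blast+
    then have "word_dist G S (g \<otimes> h) g = word_norm G S h"
      "word_dist G S (g \<otimes> h) h = word_norm G S g"
      using g h by (simp_all add: word_dist_one)
    then have "\<bar>f (g \<otimes> h) - f g\<bar> \<le> C * real (word_norm G S h)"
      "\<bar>f (g \<otimes> h) - f h\<bar> \<le> C * real (word_norm G S g)"
      using lip[of "g \<otimes> h" g] lip[of "g \<otimes> h" h] g h by simp_all
    then show ?thesis
      using norm[OF g] norm[OF h] by (auto simp: min_def)
  qed
  then show ?thesis
    unfolding partial_quasimorphism_def using C by (intro exI[of _ "2 * C"]) auto
qed

lemma lipschitz_imp_bounded_on_generators:
  assumes S: "S \<subseteq> carrier G"
    and lip: "lipschitz_wrt G (word_dist G S) f" and f1: "f \<one> = 0"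
  shows "bounded_on_set S f"
proof -
  obtain C where C: "C > 0"
    and lip: "\<And>g h. \<lbrakk>g \<in> carrier G; h \<in> carrier G\<rbrakk> \<Longrightarrow> \<bar>f g - f h\<bar> \<le> C * real (word_dist G S g h)"
    using lip by (auto simp: lipschitz_wrt_def)
  have "\<bar>f s\<bar> \<le> C" if s: "s \<in> S" for s
  proof -
    have "\<bar>f s\<bar> \<le> C * real (word_norm G S s)"
      using lip[of s \<one>] s S f1 by (auto simp: word_dist_one)
    also have "\<dots> \<le> C * 1"
      using word_norm_generator[OF S s] C by (intro mult_left_mono) auto
    finally show ?thesis by simp
  qed
  then show ?thesis
    unfolding bounded_on_set_def by (intro bdd_aboveI[of _ C]) auto
qed

text \<open>Each letter costs at most \<open>D + B\<close>, since a generator \<open>s\<close> has \<open>\<parallel>s\<parallel> \<le> 1\<close> and hence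
  \<open>\<bar>f (s h) - f h\<bar> \<le> \<bar>f s\<bar> + D \<parallel>s\<parallel>\<close> however large \<open>\<parallel>h\<parallel>\<close> is.\<close>

lemma partial_quasimorphism_word_bound:
  fixes f :: "'a \<Rightarrow> real"
  assumes S: "S \<subseteq> carrier G" and D: "D \<ge> 0"
    and pq: "\<And>g h. \<lbrakk>g \<in> carrier G; h \<in> carrier G\<rbrakk> \<Longrightarrow>
      \<bar>f g - f (g \<otimes> h) + f h\<bar> \<le> D * real (min (word_norm G S g) (word_norm G S h))"
    and B: "\<And>s. s \<in> S \<Longrightarrow> \<bar>f s\<bar> \<le> B"
    and h: "h \<in> carrier G" and w: "set w \<subseteq> S"
  shows "\<bar>f (foldr (\<otimes>) w \<one> \<otimes> h) - f h\<bar> \<le> (D + B) * real (length w)"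
  using w
proof (induction w)
  case Nil
  then show ?case using h by simp
next
  case (Cons s w)
  define u where "u = foldr (\<otimes>) w \<one> \<otimes> h"
  have s: "s \<in> S" "s \<in> carrier G" and w: "foldr (\<otimes>) w \<one> \<in> carrier G"
    using Cons.prems S by (auto intro!: foldr_mult_closed)
  have u: "u \<in> carrier G" using w h by (simp add: u_def)
  have IH: "\<bar>f u - f h\<bar> \<le> (D + B) * real (length w)"
    using Cons by (simp add: u_def)
  have "\<bar>f s - f (s \<otimes> u) + f u\<bar> \<le> D * real (min (word_norm G S s) (word_norm G S u))"
    using pq s u by blast
  also have "\<dots> \<le> D * 1"
    using word_norm_generator[OF S s(1)] D by (intro mult_left_mono) auto
  finally have "\<bar>f (s \<otimes> u) - f u\<bar> \<le> D + B"
    using B[OF s(1)] by linarith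
  then have "\<bar>f (s \<otimes> u) - f h\<bar> \<le> (D + B) * real (length (s # w))"
    using IH by (simp add: algebra_simps)
  moreover have "foldr (\<otimes>) (s # w) \<one> \<otimes> h = s \<otimes> u"
    using s w h by (simp add: u_def m_assoc)
  ultimately show ?case by simp
qed

lemma partial_quasimorphism_one:
  assumes "partial_quasimorphism G (word_norm G S) f"
  shows "f \<one> = 0"
proof -
  obtain D where "\<bar>f \<one> - f (\<one> \<otimes> \<one>) + f \<one>\<bar> \<le> D * real (min (word_norm G S \<one>) (word_norm G S \<one>))"
    using assms unfolding partial_quasimorphism_def by (meson one_closed)
  then show ?thesis by (simp add: word_norm_one)
qed

lemma partial_quasimorphism_imp_lipschitz:
  assumes S: "symmetric_generating_set G S"
    and pq: "partial_quasimorphism G (word_norm G S) f" and bd: "bounded_on_set S f"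
  shows "lipschitz_wrt G (word_dist G S) f"
proof -
  obtain D where D: "D \<ge> 0"
    and pq: "\<And>g h. \<lbrakk>g \<in> carrier G; h \<in> carrier G\<rbrakk> \<Longrightarrow>
      \<bar>f g - f (g \<otimes> h) + f h\<bar> \<le> D * real (min (word_norm G S g) (word_norm G S h))"
    using pq by (auto simp: partial_quasimorphism_def)
  obtain B0 where B0: "\<And>s. s \<in> S \<Longrightarrow> \<bar>f s\<bar> \<le> B0"
    using bd by (auto simp: bounded_on_set_def bdd_above_def)
  \<comment> \<open>A Lipschitz constant has to be positive, also when \<open>D\<close> and \<open>f\<close> on \<open>S\<close> are zero.\<close>
  define B where "B = \<bar>B0\<bar> + 1"
  have B: "\<And>s. s \<in> S \<Longrightarrow> \<bar>f s\<bar> \<le> B" using B0 by (force simp: B_def)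
  have "\<bar>f g - f h\<bar> \<le> (D + B) * real (word_dist G S g h)"
    if g: "g \<in> carrier G" and h: "h \<in> carrier G" for g h
  proof -
    obtain w where w: "set w \<subseteq> S" "foldr (\<otimes>) w \<one> = g \<otimes> inv h"
      "length w = word_norm G S (g \<otimes> inv h)"
      using shortest_word_exists[OF S, of "g \<otimes> inv h"] g h by auto
    have "\<bar>f (foldr (\<otimes>) w \<one> \<otimes> h) - f h\<bar> \<le> (D + B) * real (length w)"
      using symmetric_generating_setD(1)[OF S] D pq B h w(1)
      by (rule partial_quasimorphism_word_bound)
    then show ?thesis
      using w g h by (simp add: word_dist_def m_assoc)
  qed
  moreover have "D + B > 0" using D by (simp add: B_def)
  ultimately show ?thesis unfolding lipschitz_wrt_def by blast
qed

lemma homogeneous_lipschitz_imp_undistorted: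
  assumes g: "g \<in> carrier G" and hom: "homogeneous G f" and pos: "f g > 0"
    and lip: "lipschitz_wrt G (word_dist G S) f"
  shows "undistorted G (word_norm G S) g"
proof -
  obtain C where C: "C > 0"
    and lip: "\<And>g h. \<lbrakk>g \<in> carrier G; h \<in> carrier G\<rbrakk> \<Longrightarrow> \<bar>f g - f h\<bar> \<le> C * real (word_dist G S g h)"
    using lip by (auto simp: lipschitz_wrt_def)
  have hom: "f (x [^] n) = real n * f x" if "x \<in> carrier G" for x and n :: nat
    using hom that by (simp add: homogeneous_def)
  have f1: "f \<one> = 0" using hom[of \<one> 0] by simp
  have "f g / C * real n \<le> real (word_norm G S (g [^] n))" for n :: nat
  proof -
    have "real n * f g \<le> C * real (word_norm G S (g [^] n))"
      using lip[of "g [^] n" \<one>] hom[OF g, of n] g f1 by (simp add: word_dist_one)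
    then show ?thesis using C by (simp add: field_simps)
  qed
  then show ?thesis
    unfolding undistorted_def using pos C by (intro exI[of _ "f g / C"]) auto
qed

lemma undistorted_imp_homogeneous_lipschitz:
  assumes S: "symmetric_generating_set G S" and bi: "bi_invariant G (word_dist G S)"
    and g: "g \<in> carrier G" and und: "undistorted G (word_norm G S) g"
  obtains f :: "'a \<Rightarrow> real" where "antisymmetric G f" "homogeneous G f" "f g > 0"
    "lipschitz_wrt G (word_dist G S) f"
proof -
  interpret W: bi_invariant_pseudometric G "\<lambda>x y. real (word_dist G S x y)"
    using S bi by (rule bi_invariant_pseudometric_word_dist)
  obtain C :: real where C: "C > 0" "\<And>n::nat. C * real n \<le> real (word_norm G S (g [^] n))"
    using und by (auto simp: undistorted_def)
  have "C \<le> W.asym_dist \<one> g"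
  proof (rule W.asym_dist_greatest)
    fix n :: nat assume "n > 0"
    then show "C \<le> real (word_dist G S (\<one> [^] n) (g [^] n)) / real n"
      using C(2)[of n] g word_dist_sym[OF S, of \<one> "g [^] n"]
      by (simp add: word_dist_one pos_le_divide_eq)
  qed
  with C(1) have "W.asym_dist \<one> g > 0" by simp
  from W.homogeneous_lipschitz_function_exists[OF g this]
  obtain f :: "'a \<Rightarrow> real" where f: "antisymmetric G f" "homogeneous G f" "f g > 0"
    "\<And>x y. \<lbrakk>x \<in> carrier G; y \<in> carrier G\<rbrakk> \<Longrightarrow> \<bar>f x - f y\<bar> \<le> real (word_dist G S x y)"
    by metis
  have "lipschitz_wrt G (word_dist G S) f"
    unfolding lipschitz_wrt_def using f(4) by (intro exI[of _ 1]) auto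
  with f(1-3) show thesis using that by blast
qed

end

theorem theorem1p1:
  fixes G :: "('a, 'b) monoid_scheme" and S :: "'a set"
  assumes "group G"
    and "symmetric_generating_set G S"
    and "bi_invariant G (word_dist G S)"
  shows "(\<forall>f :: 'a \<Rightarrow> real.
            lipschitz_wrt G (word_dist G S) f \<and> f \<one>\<^bsub>G\<^esub> = 0 \<longleftrightarrow>
            partial_quasimorphism G (word_norm G S) f \<and> bounded_on_set S f)
       \<and> (\<forall>g\<in>carrier G.
            undistorted G (word_norm G S) g \<longleftrightarrow>
            (\<exists>f :: 'a \<Rightarrow> real.
               antisymmetric G f \<and> homogeneous G f \<and>
               partial_quasimorphism G (word_norm G S) f \<and>
               f g > 0 \<and> bounded_on_set S f))"
proof -
  interpret group G by fact
  note S = \<open>symmetric_generating_set G S\<close> and bi = \<open>bi_invariant G (word_dist G S)\<close>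
  have part1: "lipschitz_wrt G (word_dist G S) f \<and> f \<one>\<^bsub>G\<^esub> = 0 \<longleftrightarrow>
      partial_quasimorphism G (word_norm G S) f \<and> bounded_on_set S f" for f :: "'a \<Rightarrow> real"
    using lipschitz_imp_partial_quasimorphism[OF S bi, of f]
      lipschitz_imp_bounded_on_generators[OF symmetric_generating_setD(1)[OF S], of f]
      partial_quasimorphism_one[of S f] partial_quasimorphism_imp_lipschitz[OF S, of f]
    by blast
  have part2: "undistorted G (word_norm G S) g \<longleftrightarrow>
      (\<exists>f :: 'a \<Rightarrow> real. antisymmetric G f \<and> homogeneous G f \<and>
         partial_quasimorphism G (word_norm G S) f \<and> f g > 0 \<and> bounded_on_set S f)"
    if g: "g \<in> carrier G" for g
  proof
    assume "undistorted G (word_norm G S) g"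
    then obtain f :: "'a \<Rightarrow> real" where f: "antisymmetric G f" "homogeneous G f" "f g > 0"
      "lipschitz_wrt G (word_dist G S) f"
      using undistorted_imp_homogeneous_lipschitz[OF S bi g] by blast
    have "f (\<one>\<^bsub>G\<^esub> [^]\<^bsub>G\<^esub> (0::nat)) = real 0 * f \<one>\<^bsub>G\<^esub>"
      using f(2) unfolding homogeneous_def by blast
    then have "f \<one>\<^bsub>G\<^esub> = 0" by simp
    with f part1[of f] show "\<exists>f :: 'a \<Rightarrow> real. antisymmetric G f \<and> homogeneous G f \<and>
        partial_quasimorphism G (word_norm G S) f \<and> f g > 0 \<and> bounded_on_set S f"
      by blast
  next
    assume "\<exists>f :: 'a \<Rightarrow> real. antisymmetric G f \<and> homogeneous G f \<and>
        partial_quasimorphism G (word_norm G S) f \<and> f g > 0 \<and> bounded_on_set S f"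
    then show "undistorted G (word_norm G S) g"
      using homogeneous_lipschitz_imp_undistorted[OF g] part1 by blast
  qed
  show ?thesis using part1 part2 by blast
qed

end
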